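(* Let $n\ge 2$, let $\Omega,T\subset\mathbb{R}^n$ be bounded domains, let $\beta>0$, and let $I:\Omega\to[0,\infty)$ and $L:T\to[0,\infty)$ be integrable functions with $\int_T L(p)\,dp=\int_\Omega I(x)\,dx$. Let $(z,w)$ be a weak solution of type A of the two-reflector problem with data $(\Omega,T,I,L,\beta)$, and let $\tilde P$ be the corresponding ray tracing map. Then $\tilde P$ minimizes the quadratic transportation cost $$P\mapsto\frac12\int_\Omega|x-P(x)|^2\,I(x)\,dx$$ among all plans $P:\Omega\to T$, and any other minimizer is equal to $\tilde P$ almost everywhere on $\operatorname{supp}(I)\setminus\{x\in\bar\Omega: I(x)=0\}$.
   Context: A domain is a nonempty open connected set; "almost everywhere" refers to Lebesgue measure. A plan is a measurable map $P:\Omega\to T$ that is measure preserving in the sense that $\int_\Omega h(P(x))I(x)\,dx=\int_T h(p)L(p)\,dp$ for all continuous functions $h$ on $\bar T$. Plans are regarded as maps defined up to sets of measure zero with respect to $I\,dx$. Paraboloids: for $p,x\in\mathbb{R}^n$ and real numbers $w,z$, $$k_{p,w}(x)=\frac{\beta^2-|x-p|^2}{2\beta}+w,\qquad h_{x,z}(p)=\frac{|x-p|^2-\beta^2}{2\beta}+z .$$ A pair $(z,w)\in C(\bar\Omega)\times C(\bar T)$ is a two-reflector of type A if $z(x)=\sup_{p\in\bar T}k_{p,w(p)}(x)$ for all $x\in\bar\Omega$ and $w(p)=\inf_{x\in\bar\Omega}h_{x,z(x)}(p)$ for all $p\in\bar T$. Ray tracing map of a two-reflector $(z,w)$ of type A: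 put $Q(x,p)=\langle x,p\rangle+\beta w(p)-\frac{|p|^2}{2}$ and $V^*(x)=\sup_{p\in\bar T}Q(x,p)$, $x\in\mathbb{R}^n$ (a convex function); $\tilde P(x)$ is the set of all $p\in\mathbb{R}^n$ with $V^*(y)\ge V^*(x)+\langle p,y-x\rangle$ for all $y\in\mathbb{R}^n$ (the subdifferential of $V^*$ at $x$). It is a single point for almost every $x$, and at such $x$ it is identified with that point, so $\tilde P$ is regarded as an almost everywhere defined map on $\Omega$. Extend $I$ by $0$ to $\mathbb{R}^n$. For a Borel set $\tau\subseteq T$ put $\tilde P^{-1}(\tau)=\{x\in\mathbb{R}^n:\tilde P(x)\cap\tau\neq\emptyset\}$ (a Lebesgue measurable set). A two-reflector $(z,w)$ of type A is a weak solution of type A of the two-reflector problem with data $(\Omega,T,I,L,\beta)$ if (i) $\tilde P:\bar\Omega\to\bar T$ is onto, i.e. for every $p\in\bar T$ there is $x\in\bar\Omega$ with $p\in\tilde P(x)$, and (ii) $\int_{\tilde P^{-1}(\tau)}I(x)\,dx=\int_\tau L(p)\,dp$ for every Borel set $\tau\subseteq T$. *)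

theory Defs
  imports "HOL-Analysis.Analysis"
begin

definition is_domain :: "'a::euclidean_space set \<Rightarrow> bool" where
  "is_domain S \<longleftrightarrow> S \<noteq> {} \<and> open S \<and> connected S"

text \<open>Intensities are real functions on the whole space whose values off their domain are
  irrelevant; this is the extension by zero.\<close>

definition zero_ext :: "'a set \<Rightarrow> ('a \<Rightarrow> real) \<Rightarrow> 'a \<Rightarrow> real" where
  "zero_ext S f x = (if x \<in> S then f x else 0)"

definition supp :: "'a::euclidean_space set \<Rightarrow> ('a \<Rightarrow> real) \<Rightarrow> 'a set" where
  "supp S f = closure {x. zero_ext S f x \<noteq> 0}"

subsection \<open>Plans\<close>

definition plan_map ::
  "'a::euclidean_space set \<Rightarrow> 'a set \<Rightarrow> ('a \<Rightarrow> real) \<Rightarrow> ('a \<Rightarrow> real) \<Rightarrow> ('a \<Rightarrow> 'a) \<Rightarrow> bool" where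
  "plan_map \<Omega> T I L P \<longleftrightarrow>
     P \<in> measurable (lebesgue_on \<Omega>) (restrict_space borel T) \<and>
     (\<forall>h :: 'a \<Rightarrow> real. continuous_on (closure T) h \<longrightarrow>
        (LINT x:\<Omega>|lebesgue. h (P x) * I x) = (LINT p:T|lebesgue. h p * L p))"

text \<open>A plan is an equivalence class of such maps modulo null sets of the measure \<open>I dx\<close>.  The
  following says that \<open>P\<close> belongs to such a class, so \<open>P\<close> itself may be arbitrary on an
  \<open>I dx\<close>-null set.\<close>

definition plan ::
  "'a::euclidean_space set \<Rightarrow> 'a set \<Rightarrow> ('a \<Rightarrow> real) \<Rightarrow> ('a \<Rightarrow> real) \<Rightarrow> ('a \<Rightarrow> 'a) \<Rightarrow> bool" where
  "plan \<Omega> T I L P \<longleftrightarrow>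
     (\<exists>P'. plan_map \<Omega> T I L P' \<and>
        (AE x in density (lebesgue_on \<Omega>) (\<lambda>x. ennreal (I x)). P x = P' x))"

definition quadratic_cost ::
  "'a::euclidean_space set \<Rightarrow> ('a \<Rightarrow> real) \<Rightarrow> ('a \<Rightarrow> 'a) \<Rightarrow> real" where
  "quadratic_cost \<Omega> I P = 1 / 2 * (LINT x:\<Omega>|lebesgue. (norm (x - P x))\<^sup>2 * I x)"

definition minimizing_plan ::
  "'a::euclidean_space set \<Rightarrow> 'a set \<Rightarrow> ('a \<Rightarrow> real) \<Rightarrow> ('a \<Rightarrow> real) \<Rightarrow> ('a \<Rightarrow> 'a) \<Rightarrow> bool" where
  "minimizing_plan \<Omega> T I L P \<longleftrightarrow> plan \<Omega> T I L P \<and>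
     (\<forall>P'. plan \<Omega> T I L P' \<longrightarrow> quadratic_cost \<Omega> I P \<le> quadratic_cost \<Omega> I P')"

subsection \<open>Two-reflectors of type A\<close>

definition paraboloid_k :: "real \<Rightarrow> 'a::euclidean_space \<Rightarrow> real \<Rightarrow> 'a \<Rightarrow> real" where
  "paraboloid_k \<beta> p w x = (\<beta>\<^sup>2 - (norm (x - p))\<^sup>2) / (2 * \<beta>) + w"

definition paraboloid_h :: "real \<Rightarrow> 'a::euclidean_space \<Rightarrow> real \<Rightarrow> 'a \<Rightarrow> real" where
  "paraboloid_h \<beta> x z p = ((norm (x - p))\<^sup>2 - \<beta>\<^sup>2) / (2 * \<beta>) + z"

text \<open>In all suprema and infima below, for bounded nonempty sets the functions are continuous on a
  nonempty compact index set, so the real-valued \<open>SUP\<close> and \<open>INF\<close> are the genuine ones.\<close>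

definition two_reflector_A ::
  "'a::euclidean_space set \<Rightarrow> 'a set \<Rightarrow> real \<Rightarrow> ('a \<Rightarrow> real) \<Rightarrow> ('a \<Rightarrow> real) \<Rightarrow> bool" where
  "two_reflector_A \<Omega> T \<beta> z w \<longleftrightarrow>
     continuous_on (closure \<Omega>) z \<and> continuous_on (closure T) w \<and>
     (\<forall>x\<in>closure \<Omega>. z x = (SUP p\<in>closure T. paraboloid_k \<beta> p (w p) x)) \<and>
     (\<forall>p\<in>closure T. w p = (INF x\<in>closure \<Omega>. paraboloid_h \<beta> x (z x) p))"

definition Q_fun :: "real \<Rightarrow> ('a::euclidean_space \<Rightarrow> real) \<Rightarrow> 'a \<Rightarrow> 'a \<Rightarrow> real" where
  "Q_fun \<beta> w x p = x \<bullet> p + \<beta> * w p - (norm p)\<^sup>2 / 2"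

definition V_star ::
  "'a::euclidean_space set \<Rightarrow> real \<Rightarrow> ('a \<Rightarrow> real) \<Rightarrow> 'a \<Rightarrow> real" where
  "V_star T \<beta> w x = (SUP p\<in>closure T. Q_fun \<beta> w x p)"

definition subdifferential :: "('a::euclidean_space \<Rightarrow> real) \<Rightarrow> 'a \<Rightarrow> 'a set" where
  "subdifferential f x = {p. \<forall>y. f y \<ge> f x + p \<bullet> (y - x)}"

definition ray_set ::
  "'a::euclidean_space set \<Rightarrow> real \<Rightarrow> ('a \<Rightarrow> real) \<Rightarrow> 'a \<Rightarrow> 'a set" where
  "ray_set T \<beta> w x = subdifferential (V_star T \<beta> w) x"

text \<open>The ray tracing map as a point map.  Its value is unspecified where \<open>ray_set\<close> is not a
  singleton, which for the convex function \<open>V_star\<close> happens only on a Lebesgue null set.\<close>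

definition ray_map ::
  "'a::euclidean_space set \<Rightarrow> real \<Rightarrow> ('a \<Rightarrow> real) \<Rightarrow> 'a \<Rightarrow> 'a" where
  "ray_map T \<beta> w x = (THE p. ray_set T \<beta> w x = {p})"

definition ray_preimage ::
  "'a::euclidean_space set \<Rightarrow> real \<Rightarrow> ('a \<Rightarrow> real) \<Rightarrow> 'a set \<Rightarrow> 'a set" where
  "ray_preimage T \<beta> w \<tau> = {x. ray_set T \<beta> w x \<inter> \<tau> \<noteq> {}}"

definition weak_solution_A ::
  "'a::euclidean_space set \<Rightarrow> 'a set \<Rightarrow> ('a \<Rightarrow> real) \<Rightarrow> ('a \<Rightarrow> real) \<Rightarrow> real \<Rightarrow>
    ('a \<Rightarrow> real) \<Rightarrow> ('a \<Rightarrow> real) \<Rightarrow> bool" where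
  "weak_solution_A \<Omega> T I L \<beta> z w \<longleftrightarrow>
     two_reflector_A \<Omega> T \<beta> z w \<and>
     (\<forall>p\<in>closure T. \<exists>x\<in>closure \<Omega>. p \<in> ray_set T \<beta> w x) \<and>
     (\<forall>\<tau>. \<tau> \<in> sets borel \<and> \<tau> \<subseteq> T \<longrightarrow>
        (LINT x:ray_preimage T \<beta> w \<tau>|lebesgue. zero_ext \<Omega> I x) = (LINT p:\<tau>|lebesgue. L p))"

end

(* Writing V for V_star, every x and every p in the closure of T satisfy
   x . p + beta w(p) - |p|^2/2 <= V(x).  Substituted into |x - P(x)|^2/2 and integrated against I dx, this bounds the cost of any plan P from below by
   a quantity independent of P, because the integral of w(P(x)) I(x) is that of w L.  Equality forces
   P(x) to maximise p |-> x . p + beta w(p) - |p|^2/2, hence to be a subgradient of V at x, and for almost every x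
   the only subgradient is the ray tracing map.  The weak solution condition makes the ray tracing
   map a plan, and it attains the bound.

   The subdifferential is single-valued almost everywhere without appeal to Rademacher's theorem:
   along a line in direction e the e-components of subgradients are monotone, so they can be
   ambiguous only at the countably many jumps, and Fubini makes the exceptional set null. *)

theory Submission
  imports Defs
begin

section \<open>Almost everywhere single-valuedness of subdifferentials\<close>

text \<open>By translation invariance, averaging the measure of \<open>A\<close> over shifts along
  \<open>e\<close> changes nothing; after exchanging the integrals, each inner integral runs over a
  countable set of parameters and vanishes.\<close>

lemma lborel_null_if_countable_lines:
  fixes A :: "'a::euclidean_space set"
  assumes A[measurable]: "A \<in> sets borel"
    and lines: "\<And>x. countable {t. x + t *\<^sub>R e \<in> A}"
  shows "A \<in> null_sets lborel"
proof -
  \<comment> \<open>A weight of total integral 1, so that the average over the shifts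
    \<open>t\<close> is exactly the measure of \<open>A\<close>.\<close>
  let ?u = "indicator {0..1} :: real \<Rightarrow> ennreal"
  have shift: "(\<integral>\<^sup>+x. indicator A (x + t *\<^sub>R e) \<partial>lborel) = emeasure lborel A" for t
  proof -
    have "emeasure lborel A = (\<integral>\<^sup>+x. indicator A x \<partial>distr lborel borel (\<lambda>x. t *\<^sub>R e + x))"
      by (simp add: lborel_distr_plus)
    also have "\<dots> = (\<integral>\<^sup>+x. indicator A (x + t *\<^sub>R e) \<partial>lborel)"
      by (subst nn_integral_distr) (auto simp: add.commute)
    finally show ?thesis by simp
  qed
  have "emeasure lborel A = (\<integral>\<^sup>+t. ?u t * emeasure lborel A \<partial>lborel)"
    by (simp add: nn_integral_multc)
  also have "\<dots> = (\<integral>\<^sup>+t. (\<integral>\<^sup>+x. ?u t * indicator A (x + t *\<^sub>R e) \<partial>lborel) \<partial>lborel)"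
    by (simp add: shift nn_integral_cmult)
  also have "\<dots> = (\<integral>\<^sup>+x. (\<integral>\<^sup>+t. ?u t * indicator A (x + t *\<^sub>R e) \<partial>lborel) \<partial>lborel)"
    by (rule lborel_pair.Fubini') measurable
  also have "\<dots> = (\<integral>\<^sup>+x. 0 \<partial>(lborel :: 'a measure))"
  proof (rule nn_integral_cong)
    fix x
    have "AE t in lborel. t \<notin> {t. x + t *\<^sub>R e \<in> A}"
      by (intro AE_not_in countable_imp_null_set_lborel lines)
    then have "AE t in lborel. ?u t * indicator A (x + t *\<^sub>R e) = 0"
      by eventually_elim simp
    then show "(\<integral>\<^sup>+t. ?u t * indicator A (x + t *\<^sub>R e) \<partial>lborel) = 0"
      by (subst nn_integral_0_iff_AE) auto
  qed
  finally show ?thesis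
    using A by (simp add: null_sets_def)
qed

text \<open>Apply each subgradient inequality at the base point of the other and add: the values of
  \<open>f\<close> cancel.\<close>

lemma subdifferential_mono:
  assumes "p \<in> subdifferential f x" "q \<in> subdifferential f y"
  shows "0 \<le> (q - p) \<bullet> (y - x)"
proof -
  have "f y \<ge> f x + p \<bullet> (y - x)" "f x \<ge> f y + q \<bullet> (x - y)"
    using assms by (auto simp: subdifferential_def)
  then show ?thesis by (simp add: algebra_simps)
qed

text \<open>A subgradient at an intermediate point \<open>?z\<close> gives an affine minorant
  touching \<open>f\<close> there. Its values at \<open>x\<close> and \<open>y\<close> combine to
  \<open>f ?z\<close>, so \<open>f\<close> is convex, and a finite convex function on a Euclidean
  space is continuous.\<close>

lemma continuous_if_subdifferential_nonempty:
  fixes f :: "'a::euclidean_space \<Rightarrow> real"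
  assumes "\<And>x. subdifferential f x \<noteq> {}"
  shows "continuous_on UNIV f"
proof (rule convex_on_continuous[OF open_UNIV], rule convex_onI)
  fix t :: real and x y :: 'a
  assume t: "0 < t" "t < 1"
  let ?z = "(1 - t) *\<^sub>R x + t *\<^sub>R y"
  obtain p where "p \<in> subdifferential f ?z" using assms by blast
  then have "f x \<ge> f ?z + p \<bullet> (x - ?z)" "f y \<ge> f ?z + p \<bullet> (y - ?z)"
    by (auto simp: subdifferential_def)
  then have "(1 - t) * f x + t * f y
      \<ge> (1 - t) * (f ?z + p \<bullet> (x - ?z)) + t * (f ?z + p \<bullet> (y - ?z))"
    using t by (intro add_mono mult_left_mono) auto
  also have "(1 - t) * (f ?z + p \<bullet> (x - ?z)) + t * (f ?z + p \<bullet> (y - ?z)) = f ?z"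
    by (simp add: inner_diff_right inner_add_right algebra_simps)
  finally show "f ?z \<le> (1 - t) * f x + t * f y" .
qed simp

text \<open>The graph of the subdifferential is an intersection over \<open>y\<close> of closed
  sets, and projecting along the compact factor \<open>C\<close> keeps it closed.\<close>

lemma closed_subdifferential_preimage:
  fixes f :: "'a::euclidean_space \<Rightarrow> real"
  assumes "continuous_on UNIV f" "compact C"
  shows "closed {x. subdifferential f x \<inter> C \<noteq> {}}"
proof -
  have "closed {(p, x). \<forall>y. f x + p \<bullet> (y - x) \<le> f y}"
    unfolding case_prod_unfold
    by (intro closed_Collect_all closed_Collect_le continuous_intros
        continuous_on_compose2[OF assms(1)]) auto
  then have "closed {x. \<exists>p. p \<in> C \<and> (p, x) \<in> {(p, x). \<forall>y. f x + p \<bullet> (y - x) \<le> f y} \<inter> C \<times> UNIV}"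
    using closed_compact_projection[OF assms(2), of "{(p, x). \<forall>y. f x + p \<bullet> (y - x) \<le> f y} \<inter> C \<times> UNIV"]
      compact_imp_closed[OF assms(2)]
    by (auto intro: closed_Int closed_Times)
  moreover have "{x. \<exists>p. p \<in> C \<and> (p, x) \<in> {(p, x). \<forall>y. f x + p \<bullet> (y - x) \<le> f y} \<inter> C \<times> UNIV}
      = {x. subdifferential f x \<inter> C \<noteq> {}}"
    by (auto simp: subdifferential_def)
  ultimately show ?thesis by simp
qed

text \<open>Exhausting \<open>C\<close> by its intersections with balls gives a countable union of
  the closed sets from the compact case.\<close>

lemma borel_subdifferential_preimage:
  fixes f :: "'a::euclidean_space \<Rightarrow> real"
  assumes "continuous_on UNIV f" "closed C"
  shows "{x. subdifferential f x \<inter> C \<noteq> {}} \<in> sets borel"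
proof -
  have "{x. subdifferential f x \<inter> C \<noteq> {}}
      = (\<Union>n. {x. subdifferential f x \<inter> (C \<inter> cball 0 (real n)) \<noteq> {}})"
    (is "_ = ?U")
  proof (intro equalityI subsetI)
    fix x assume "x \<in> {x. subdifferential f x \<inter> C \<noteq> {}}"
    then obtain p where p: "p \<in> subdifferential f x" "p \<in> C" by auto
    obtain n where "norm p \<le> real n" using real_arch_simple by blast
    then have "p \<in> subdifferential f x \<inter> (C \<inter> cball 0 (real n))" using p by simp
    then show "x \<in> ?U" by blast
  qed auto
  moreover have "closed {x. subdifferential f x \<inter> (C \<inter> cball 0 (real n)) \<noteq> {}}" for n
    using assms by (intro closed_subdifferential_preimage closed_Int_compact) auto
  ultimately show ?thesis by (auto intro: borel_closed)
qed

text \<open>The \<open>e\<close>-component of any selection \<open>m\<close> of subgradients is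
  monotone along the line, hence has countably many discontinuities; at a point of continuity all
  subgradients share this component.\<close>

lemma countable_line_subdifferential_jumps:
  fixes f :: "'a::euclidean_space \<Rightarrow> real"
  assumes ne: "\<And>x. subdifferential f x \<noteq> {}"
  shows "countable {t. \<exists>p\<in>subdifferential f (x + t *\<^sub>R e).
    \<exists>q\<in>subdifferential f (x + t *\<^sub>R e). p \<bullet> e < q \<bullet> e}"
proof -
  define m where "m t = (SOME p. p \<in> subdifferential f (x + t *\<^sub>R e))" for t
  have m: "m t \<in> subdifferential f (x + t *\<^sub>R e)" for t
    unfolding m_def using ne some_in_eq by blast
  \<comment> \<open>The strict \<open>s < t\<close> is essential: at one and the same parameter the
    components of two subgradients may come in either order.\<close>
  have mono_sub: "p \<bullet> e \<le> q \<bullet> e"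
    if "s < t" "p \<in> subdifferential f (x + s *\<^sub>R e)" "q \<in> subdifferential f (x + t *\<^sub>R e)"
    for s t p q
  proof -
    have "0 \<le> (q - p) \<bullet> ((x + t *\<^sub>R e) - (x + s *\<^sub>R e))"
      by (rule subdifferential_mono[OF that(2,3)])
    also have "\<dots> = (t - s) * ((q - p) \<bullet> e)"
      by (simp add: algebra_simps)
    finally show ?thesis using that(1) by (simp add: zero_le_mult_iff inner_diff_left)
  qed
  have "mono (\<lambda>t. m t \<bullet> e)"
    by (rule monoI) (metis m mono_sub order_le_less)
  then have countable_discont: "countable {t. \<not> isCont (\<lambda>t. m t \<bullet> e) t}"
    by (rule mono_ctble_discont)
  \<comment> \<open>Any subgradient at \<open>t\<close> is squeezed between the values of
    \<open>m\<close> to the left and to the right, which both tend to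
    \<open>m t \<bullet> e\<close>.\<close>
  have eq: "p \<bullet> e = m t \<bullet> e"
    if cont: "isCont (\<lambda>t. m t \<bullet> e) t" and p: "p \<in> subdifferential f (x + t *\<^sub>R e)" for t p
  proof (rule antisym)
    have lim: "((\<lambda>t. m t \<bullet> e) \<longlongrightarrow> m t \<bullet> e) (at t)"
      using cont by (simp add: isCont_def)
    show "p \<bullet> e \<le> m t \<bullet> e"
    proof (rule tendsto_lowerbound)
      show "((\<lambda>t. m t \<bullet> e) \<longlongrightarrow> m t \<bullet> e) (at_right t)"
        using lim by (rule filterlim_mono) (auto simp: at_within_le_at)
      show "\<forall>\<^sub>F s in at_right t. p \<bullet> e \<le> m s \<bullet> e"
        unfolding eventually_at_filter
        by (intro always_eventually) (auto intro: mono_sub[OF _ p m])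
    qed simp
    show "m t \<bullet> e \<le> p \<bullet> e"
    proof (rule tendsto_upperbound)
      show "((\<lambda>t. m t \<bullet> e) \<longlongrightarrow> m t \<bullet> e) (at_left t)"
        using lim by (rule filterlim_mono) (auto simp: at_within_le_at)
      show "\<forall>\<^sub>F s in at_left t. m s \<bullet> e \<le> p \<bullet> e"
        unfolding eventually_at_filter
        by (intro always_eventually) (auto intro: mono_sub[OF _ m p])
    qed simp
  qed
  have "{t. \<exists>p\<in>subdifferential f (x + t *\<^sub>R e).
      \<exists>q\<in>subdifferential f (x + t *\<^sub>R e). p \<bullet> e < q \<bullet> e} \<subseteq> {t. \<not> isCont (\<lambda>t. m t \<bullet> e) t}"
  proof (intro subsetI CollectI notI)
    fix t
    assume "t \<in> {t. \<exists>p\<in>subdifferential f (x + t *\<^sub>R e).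
      \<exists>q\<in>subdifferential f (x + t *\<^sub>R e). p \<bullet> e < q \<bullet> e}" "isCont (\<lambda>t. m t \<bullet> e) t"
    then obtain p q where "p \<in> subdifferential f (x + t *\<^sub>R e)"
      "q \<in> subdifferential f (x + t *\<^sub>R e)" "p \<bullet> e < q \<bullet> e" by blast
    with eq[of t p] eq[of t q] \<open>isCont (\<lambda>t. m t \<bullet> e) t\<close> show False by simp
  qed
  then show ?thesis
    using countable_discont by (rule countable_subset)
qed

text \<open>If two subgradients differ, they differ in some coordinate, so the exceptional set is
  the finite union over \<open>Basis\<close> of the jump sets \<open>J e\<close>, each null by its
  countable line sections.\<close>

lemma subdifferential_single_valued_AE:
  fixes f :: "'a::euclidean_space \<Rightarrow> real"
  assumes ne: "\<And>x. subdifferential f x \<noteq> {}"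
  obtains N g where "N \<in> null_sets lborel" "g \<in> borel_measurable borel"
    "\<And>x. x \<notin> N \<Longrightarrow> subdifferential f x = {g x}"
proof -
  note cont = continuous_if_subdifferential_nonempty[OF ne]
  define J where "J e = {x. \<exists>p\<in>subdifferential f x. \<exists>q\<in>subdifferential f x. p \<bullet> e < q \<bullet> e}" for e
  have "J e \<in> null_sets lborel" for e
  proof (rule lborel_null_if_countable_lines)
    \<comment> \<open>Two rationals \<open>r < s\<close> separate the components, so that both
      half-spaces can be closed while the gap between them stays strict.\<close>
    have "J e = (\<Union>r\<in>\<rat>. \<Union>s\<in>{s\<in>\<rat>. r < s}.
        {x. subdifferential f x \<inter> {p. p \<bullet> e \<le> r} \<noteq> {}} \<inter> {x. subdifferential f x \<inter> {p. s \<le> p \<bullet> e} \<noteq> {}})"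
      (is "_ = ?U")
    proof (intro equalityI subsetI)
      fix x assume "x \<in> J e"
      then obtain p q where pq: "p \<in> subdifferential f x" "q \<in> subdifferential f x" "p \<bullet> e < q \<bullet> e"
        by (auto simp: J_def)
      obtain r where r: "r \<in> \<rat>" "p \<bullet> e < r" "r < q \<bullet> e"
        using Rats_dense_in_real[OF pq(3)] by blast
      obtain s where s: "s \<in> \<rat>" "r < s" "s < q \<bullet> e"
        using Rats_dense_in_real[OF r(3)] by blast
      have "p \<in> subdifferential f x \<inter> {p. p \<bullet> e \<le> r}" "q \<in> subdifferential f x \<inter> {p. s \<le> p \<bullet> e}"
        using pq r s by auto
      then show "x \<in> ?U" using r(1) s by blast
    next
      fix x assume "x \<in> ?U"
      then show "x \<in> J e" unfolding J_def by fastforce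
    qed
    moreover have "\<dots> \<in> sets borel"
      using countable_rat
      by (intro sets.countable_UN'' sets.Int borel_subdifferential_preimage[OF cont] countable_Collect
          closed_Collect_le continuous_intros) auto
    ultimately show "J e \<in> sets borel" by simp
    show "countable {t. x + t *\<^sub>R e \<in> J e}" for x
      using countable_line_subdifferential_jumps[OF ne, of x e] by (simp add: J_def)
  qed
  define N where "N = (\<Union>e\<in>Basis. J e)"
  \<comment> \<open>The constant value 0 on \<open>N\<close> makes each preimage contain all of
    \<open>N\<close> or none of it, which keeps \<open>g\<close> Borel.\<close>
  define g where "g x = (if x \<in> N then 0 else THE p. subdifferential f x = {p})" for x
  have N: "N \<in> null_sets lborel"
    unfolding N_def using \<open>\<And>e. J e \<in> null_sets lborel\<close> by (intro null_sets.finite_UN) auto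
  have g: "subdifferential f x = {g x}" if "x \<notin> N" for x
  proof -
    have le: "p \<bullet> e \<le> q \<bullet> e"
      if "p \<in> subdifferential f x" "q \<in> subdifferential f x" "e \<in> Basis" for p q e
      using that \<open>x \<notin> N\<close> by (auto simp: N_def J_def not_less)
    have eq: "p = q" if "p \<in> subdifferential f x" "q \<in> subdifferential f x" for p q
      using le that by (intro euclidean_eqI[of p q]) (simp add: order_antisym)
    obtain p where "p \<in> subdifferential f x" using ne[of x] by blast
    then have "subdifferential f x = {p}" using eq by blast
    then show ?thesis using that by (simp add: g_def)
  qed
  have g_zero: "g x = 0" if "x \<in> N" for x
    using that by (simp add: g_def)
  have vimage_closed: "g -` C \<in> sets borel" if "closed C" for C
  proof -
    have "g -` C = ({x. subdifferential f x \<inter> C \<noteq> {}} - N) \<union> (if 0 \<in> C then N else {})"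
    proof (rule set_eqI)
      fix x show "x \<in> g -` C \<longleftrightarrow> x \<in> ({x. subdifferential f x \<inter> C \<noteq> {}} - N) \<union> (if 0 \<in> C then N else {})"
        using g[of x] g_zero[of x] by (cases "x \<in> N") simp_all
    qed
    then show ?thesis
      using N borel_subdifferential_preimage[OF cont that] by (auto simp: null_sets_def)
  qed
  have "g \<in> borel_measurable borel"
  proof (rule borel_measurableI)
    fix S :: "'a set" assume "open S"
    then have "- (g -` (- S)) \<in> sets borel"
      by (intro borel_comp vimage_closed) (simp add: closed_Compl)
    then show "g -` S \<inter> space borel \<in> sets borel"
      by (simp add: vimage_Compl)
  qed
  then show thesis using that N g by blast
qed

section \<open>Almost everywhere equality and weighted Lebesgue measures\<close>

lemma (in complete_measure) borel_measurable_cong_AE: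
  assumes "f \<in> borel_measurable M" "AE x in M. f x = g x"
  shows "g \<in> borel_measurable M"
proof (rule borel_measurableI)
  fix S :: "'b set" assume "open S"
  then have f: "f -` S \<inter> space M \<in> sets M"
    using assms(1) by (simp add: measurable_sets)
  have "AE x in M. x \<in> f -` S \<inter> space M \<longleftrightarrow> x \<in> g -` S \<inter> space M"
    using assms(2) by eventually_elim simp
  then show "g -` S \<inter> space M \<in> sets M"
    by (rule in_sets_AE[OF _ f]) simp
qed

text \<open>In a complete measure space \<open>f\<close> and \<open>g\<close> are both measurable or
  both not; in the second case both integrals have the default value 0. This lets costs be compared
  for maps that are only known up to null sets.\<close>

lemma (in complete_measure) integral_cong_AE_complete:
  fixes f g :: "'a \<Rightarrow> 'b::{banach, second_countable_topology}"
  assumes ae: "AE x in M. f x = g x"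
  shows "integral\<^sup>L M f = integral\<^sup>L M g"
proof (cases "f \<in> borel_measurable M")
  case True
  then show ?thesis
    using borel_measurable_cong_AE[OF True ae] ae by (rule integral_cong_AE)
next
  case False
  moreover have "g \<notin> borel_measurable M"
  proof
    assume "g \<in> borel_measurable M"
    moreover have "AE x in M. g x = f x"
      using ae by eventually_elim simp
    ultimately show False
      using False by (blast dest: borel_measurable_cong_AE)
  qed
  ultimately have "\<not> integrable M f" "\<not> integrable M g"
    using borel_measurable_integrable by blast+
  then show ?thesis
    by (simp add: not_integrable_integral_eq)
qed

lemma set_lebesgue_integral_cong_AE_lebesgue:
  fixes f g :: "'a::euclidean_space \<Rightarrow> real"
  assumes "AE x in lebesgue. x \<in> S \<longrightarrow> f x = g x"
  shows "(LINT x:S|lebesgue. f x) = (LINT x:S|lebesgue. g x)"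
  unfolding set_lebesgue_integral_def
  by (rule completion.integral_cong_AE_complete) (use assms in eventually_elim, auto simp: indicator_def)

lemma integrable_lebesgue_on_iff:
  fixes k :: "'a::euclidean_space \<Rightarrow> real"
  assumes "S \<in> sets lebesgue"
  shows "integrable (lebesgue_on S) k \<longleftrightarrow> set_integrable lebesgue S k"
  using assms by (simp add: integrable_restrict_space set_integrable_def)

lemma set_lebesgue_integral_eq_density:
  fixes f k :: "'a::euclidean_space \<Rightarrow> real"
  assumes S: "S \<in> sets lebesgue" and k: "set_integrable lebesgue S k" "\<And>x. x \<in> S \<Longrightarrow> 0 \<le> k x"
    and f: "f \<in> borel_measurable (lebesgue_on S)"
  shows "(LINT x:S|lebesgue. f x * k x) = (\<integral>x. f x \<partial>density (lebesgue_on S) k)"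
proof -
  have "integrable (lebesgue_on S) k"
    using k(1) S by (simp add: integrable_lebesgue_on_iff)
  then have "(\<integral>x. f x \<partial>density (lebesgue_on S) k) = (\<integral>x. k x *\<^sub>R f x \<partial>lebesgue_on S)"
    using f k(2) by (intro integral_density) auto
  also have "\<dots> = (LINT x:S|lebesgue. f x * k x)"
    using S by (simp add: integral_restrict_space set_lebesgue_integral_def mult_ac)
  finally show ?thesis by simp
qed

lemma finite_measure_density_lebesgue_on:
  fixes k :: "'a::euclidean_space \<Rightarrow> real"
  assumes S: "S \<in> sets lebesgue" and k: "set_integrable lebesgue S k"
  shows "finite_measure (density (lebesgue_on S) k)"
proof
  have int: "integrable (lebesgue_on S) k"
    using k S by (simp add: integrable_lebesgue_on_iff)
  then have "emeasure (density (lebesgue_on S) k) (space (density (lebesgue_on S) k))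
      = (\<integral>\<^sup>+x. ennreal (k x) \<partial>lebesgue_on S)"
    by (subst emeasure_density)
       (auto intro!: nn_integral_cong borel_measurable_integrable simp del: space_restrict_space)
  also have "\<dots> \<le> (\<integral>\<^sup>+x. ennreal (norm (k x)) \<partial>lebesgue_on S)"
    by (intro nn_integral_mono ennreal_leI) simp
  also have "\<dots> < \<infinity>"
    using int by (simp add: integrable_iff_bounded)
  finally show "emeasure (density (lebesgue_on S) k) (space (density (lebesgue_on S) k)) \<noteq> \<infinity>"
    by simp
qed

lemma AE_density_lebesgue_onI:
  fixes k :: "'a::euclidean_space \<Rightarrow> real"
  assumes "S \<in> sets lebesgue" "set_integrable lebesgue S k" "AE x in lebesgue. Q x"
  shows "AE x in density (lebesgue_on S) k. Q x"
proof -
  have "AE x in lebesgue_on S. Q x"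
    using assms(1,3) by (auto simp: AE_restrict_space_iff)
  moreover have "k \<in> borel_measurable (lebesgue_on S)"
    using assms(1,2) by (intro borel_measurable_integrable) (simp add: integrable_lebesgue_on_iff)
  ultimately show ?thesis by (auto simp: AE_density)
qed

text \<open>The coercion \<open>ennreal\<close> sends values of \<open>k\<close> below 0 to 0, so
  the weighted measure only sees points with \<open>0 < k x\<close>.\<close>

lemma AE_density_lebesgue_onD:
  fixes k :: "'a::euclidean_space \<Rightarrow> real"
  assumes "S \<in> sets lebesgue" "set_integrable lebesgue S k"
    and "AE x in density (lebesgue_on S) k. Q x"
  shows "AE x in lebesgue. x \<in> S \<and> 0 < k x \<longrightarrow> Q x"
proof -
  have "k \<in> borel_measurable (lebesgue_on S)"
    using assms(1,2) by (intro borel_measurable_integrable) (simp add: integrable_lebesgue_on_iff)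
  then have "AE x in lebesgue_on S. 0 < ennreal (k x) \<longrightarrow> Q x"
    using assms(3) by (subst (asm) AE_density) auto
  then show ?thesis
    using assms(1) by (simp add: AE_restrict_space_iff imp_conjL)
qed

section \<open>The convex potential \<open>V_star\<close> and its subgradients\<close>

lemma Q_fun_le_V_star:
  assumes "bounded T" "continuous_on (closure T) w" "p \<in> closure T"
  shows "Q_fun \<beta> w x p \<le> V_star T \<beta> w x"
proof -
  have "compact (Q_fun \<beta> w x ` closure T)"
    unfolding Q_fun_def using assms
    by (intro compact_continuous_image continuous_intros) (auto simp: compact_closure)
  then show ?thesis
    unfolding V_star_def using assms(3)
    by (intro cSUP_upper bounded_imp_bdd_above compact_imp_bounded)
qed

lemma V_star_attained:
  assumes "bounded T" "T \<noteq> {}" "continuous_on (closure T) w"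
  obtains p where "p \<in> closure T" "V_star T \<beta> w x = Q_fun \<beta> w x p"
proof -
  have "continuous_on (closure T) (Q_fun \<beta> w x)"
    unfolding Q_fun_def using assms by (intro continuous_intros) auto
  then obtain p where p: "p \<in> closure T" "\<And>q. q \<in> closure T \<Longrightarrow> Q_fun \<beta> w x q \<le> Q_fun \<beta> w x p"
    using continuous_attains_sup[of "closure T" "Q_fun \<beta> w x"] assms by (auto simp: compact_closure)
  then have "V_star T \<beta> w x = Q_fun \<beta> w x p"
    unfolding V_star_def by (intro cSup_eq_maximum) auto
  then show thesis using that p by blast
qed

text \<open>As a function of \<open>y\<close>, \<open>Q_fun \<beta> w y p\<close> is affine with
  slope \<open>p\<close>; it lies below \<open>V_star\<close> and touches it at
  \<open>x\<close>.\<close>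

lemma maximizer_in_ray_set:
  assumes "bounded T" "continuous_on (closure T) w" "p \<in> closure T" "V_star T \<beta> w x = Q_fun \<beta> w x p"
  shows "p \<in> ray_set T \<beta> w x"
  unfolding ray_set_def subdifferential_def
proof (intro CollectI allI)
  fix y
  have "Q_fun \<beta> w y p \<le> V_star T \<beta> w y"
    by (rule Q_fun_le_V_star[OF assms(1-3)])
  then show "V_star T \<beta> w y \<ge> V_star T \<beta> w x + p \<bullet> (y - x)"
    by (simp add: assms(4) Q_fun_def inner_diff_right inner_commute)
qed

lemma ray_set_nonempty:
  assumes "bounded T" "T \<noteq> {}" "continuous_on (closure T) w"
  shows "ray_set T \<beta> w x \<noteq> {}"
  using V_star_attained[OF assms, of \<beta> x] maximizer_in_ray_set[OF assms(1,3)] by blast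

lemma continuous_on_V_star:
  assumes "bounded T" "T \<noteq> {}" "continuous_on (closure T) w"
  shows "continuous_on UNIV (V_star T \<beta> w)"
  using ray_set_nonempty[OF assms]
  by (intro continuous_if_subdifferential_nonempty) (simp add: ray_set_def)

text \<open>Off a null set \<open>ray_map\<close> agrees with a Borel selection \<open>g\<close>. On
  that set the value of \<open>THE\<close> is uncontrolled, so measurability comes from the
  completeness of Lebesgue measure.\<close>

lemma
  assumes "bounded T" "T \<noteq> {}" "continuous_on (closure T) w"
  shows AE_ray_set_singleton: "AE x in lebesgue. ray_set T \<beta> w x = {ray_map T \<beta> w x}"
    and ray_map_lebesgue_measurable: "ray_map T \<beta> w \<in> borel_measurable lebesgue"
proof -
  obtain N g where N: "N \<in> null_sets lborel" and g: "g \<in> borel_measurable borel"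
    and sing: "\<And>x. x \<notin> N \<Longrightarrow> ray_set T \<beta> w x = {g x}"
    using subdifferential_single_valued_AE[OF ray_set_nonempty[OF assms, unfolded ray_set_def], of \<beta>]
    unfolding ray_set_def by blast
  have ae: "AE x in lebesgue. x \<notin> N"
    using N by (intro AE_not_in null_sets_completionI)
  have eq: "ray_map T \<beta> w x = g x" if "x \<notin> N" for x
    unfolding ray_map_def using sing[OF that] by auto
  show "AE x in lebesgue. ray_set T \<beta> w x = {ray_map T \<beta> w x}"
    using ae by eventually_elim (simp add: sing eq)
  have "g \<in> borel_measurable lebesgue"
    using g by (intro measurable_completion) simp
  then show "ray_map T \<beta> w \<in> borel_measurable lebesgue"
    by (rule completion.borel_measurable_cong_AE) (use ae in eventually_elim, simp add: eq)
qed

lemma continuous_on_closure_norm_boundE: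
  fixes f :: "'a::heine_borel \<Rightarrow> 'b::real_normed_vector"
  assumes "bounded S" "continuous_on (closure S) f"
  obtains B where "\<And>x. x \<in> S \<Longrightarrow> norm (f x) \<le> B"
proof -
  have "bounded (f ` closure S)"
    using assms by (intro compact_imp_bounded compact_continuous_image) (simp_all add: compact_closure)
  then obtain B where "\<forall>y\<in>f ` closure S. norm y \<le> B"
    unfolding bounded_iff by blast
  then show thesis
    using that closure_subset by blast
qed

section \<open>The ray tracing map as a plan\<close>

locale two_reflector_solution =
  fixes \<Omega> T :: "'a::euclidean_space set" and I L z w :: "'a \<Rightarrow> real" and \<beta> :: real
  assumes domain_\<Omega>: "is_domain \<Omega>" "bounded \<Omega>"
    and domain_T: "is_domain T" "bounded T"
    and I_nonneg: "\<And>x. x \<in> \<Omega> \<Longrightarrow> I x \<ge> 0" and I_int: "set_integrable lebesgue \<Omega> I"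
    and L_nonneg: "\<And>p. p \<in> T \<Longrightarrow> L p \<ge> 0" and L_int: "set_integrable lebesgue T L"
    and mass: "(LINT p:T|lebesgue. L p) = (LINT x:\<Omega>|lebesgue. I x)"
    and weak: "weak_solution_A \<Omega> T I L \<beta> z w"
begin

abbreviation "source \<equiv> density (lebesgue_on \<Omega>) (\<lambda>x. ennreal (I x))"
abbreviation "target \<equiv> density (lebesgue_on T) (\<lambda>p. ennreal (L p))"
abbreviation "V \<equiv> V_star T \<beta> w"
abbreviation "ray \<equiv> ray_map T \<beta> w"

lemma \<Omega>_sets: "\<Omega> \<in> sets lebesgue" and T_borel: "T \<in> sets borel" and T_sets: "T \<in> sets lebesgue"
  and T_nonempty: "T \<noteq> {}"
  using domain_\<Omega> domain_T by (auto simp: is_domain_def intro: lebesgue_openin)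

lemma w_continuous: "continuous_on (closure T) w"
  using weak unfolding weak_solution_A_def two_reflector_A_def by blast

lemmas w_assms = domain_T(2) T_nonempty w_continuous

sublocale source: finite_measure source
  using \<Omega>_sets I_int by (rule finite_measure_density_lebesgue_on)

sublocale target: finite_measure target
  using T_sets L_int by (rule finite_measure_density_lebesgue_on)

lemma AE_source_ray: "AE x in source. ray_set T \<beta> w x = {ray x}"
  using \<Omega>_sets I_int AE_ray_set_singleton[OF w_assms] by (rule AE_density_lebesgue_onI)

lemma borel_lebesgue_on: "f \<in> borel_measurable borel \<Longrightarrow> f \<in> borel_measurable (lebesgue_on S)"
  by (intro measurable_restrict_space1 measurable_completion) simp

lemma ray_measurable: "ray \<in> borel_measurable (lebesgue_on \<Omega>)"
  using ray_map_lebesgue_measurable[OF w_assms] by (rule measurable_restrict_space1)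

text \<open>The mass condition speaks of points whose subdifferential meets \<open>B\<close>; since
  the subdifferential is almost everywhere \<open>{ray x}\<close>, within \<Omega> these are the
  points with \<open>ray x \<in> B\<close> up to a null set.\<close>

lemma measure_source_ray_vimage:
  assumes B: "B \<in> sets borel" "B \<subseteq> T"
  shows "measure source (ray -` B \<inter> \<Omega>) = measure target B"
proof -
  have A: "ray -` B \<inter> \<Omega> \<in> sets (lebesgue_on \<Omega>)"
    using measurable_sets[OF ray_measurable B(1)] by simp
  have BT: "B \<in> sets (lebesgue_on T)"
    using B T_sets by (simp add: sets_restrict_space_iff)
  have "measure source (ray -` B \<inter> \<Omega>) = (\<integral>x. indicator (ray -` B \<inter> \<Omega>) x \<partial>source)"
    using A by simp
  also have "\<dots> = (LINT x:\<Omega>|lebesgue. indicator (ray -` B \<inter> \<Omega>) x * I x)"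
    using A by (intro set_lebesgue_integral_eq_density[symmetric] \<Omega>_sets I_int I_nonneg) auto
  also have "\<dots> = (LINT x:ray_preimage T \<beta> w B|lebesgue. zero_ext \<Omega> I x)"
    unfolding set_lebesgue_integral_def
  proof (rule completion.integral_cong_AE_complete)
    show "AE x in lebesgue. indicat_real \<Omega> x *\<^sub>R (indicat_real (ray -` B \<inter> \<Omega>) x * I x) =
        indicat_real (ray_preimage T \<beta> w B) x *\<^sub>R zero_ext \<Omega> I x"
      using AE_ray_set_singleton[OF w_assms]
      by eventually_elim (auto simp: ray_preimage_def zero_ext_def indicator_def)
  qed
  also have "\<dots> = (LINT p:B|lebesgue. L p)"
    using weak B by (simp add: weak_solution_A_def)
  also have "\<dots> = (LINT p:T|lebesgue. indicator B p * L p)"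
    unfolding set_lebesgue_integral_def using B(2)
    by (intro Bochner_Integration.integral_cong) (auto simp: indicator_def)
  also have "\<dots> = (\<integral>p. indicator B p \<partial>target)"
    using BT by (intro set_lebesgue_integral_eq_density T_sets L_int L_nonneg) auto
  also have "\<dots> = measure target B"
    using BT B(2) by (simp add: inf_absorb1)
  finally show ?thesis .
qed

text \<open>Taking \<open>B = T\<close> and using equality of the total masses, the preimage of
  \<open>T\<close> carries all of \<open>source\<close>, so its complement is null.\<close>

lemma AE_source_ray_in_T: "AE x in source. ray x \<in> T"
proof -
  have "measure source \<Omega> = (LINT x:\<Omega>|lebesgue. 1 * I x)"
    by (subst set_lebesgue_integral_eq_density[OF \<Omega>_sets I_int I_nonneg]) simp_all
  also have "\<dots> = (LINT p:T|lebesgue. 1 * L p)"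
    using mass by simp
  also have "\<dots> = measure target T"
    by (subst set_lebesgue_integral_eq_density[OF T_sets L_int L_nonneg]) simp_all
  also have "\<dots> = measure source (ray -` T \<inter> \<Omega>)"
    by (rule measure_source_ray_vimage[symmetric]) (simp_all add: T_borel)
  finally have eq: "measure source (ray -` T \<inter> \<Omega>) = measure source (space source)"
    by simp
  have A: "ray -` T \<inter> \<Omega> \<in> sets source"
    using measurable_sets[OF ray_measurable T_borel] by simp
  have "measure source (space source - (ray -` T \<inter> \<Omega>)) = 0"
    using source.finite_measure_compl[OF A] eq by simp
  then have "space source - (ray -` T \<inter> \<Omega>) \<in> null_sets source"
    using A by (auto simp: null_sets_def source.emeasure_eq_measure)
  then show ?thesis
    by (rule AE_I') auto
qed

text \<open>The mass condition covers Borel subsets of \<open>T\<close> only, so \<open>B\<close> is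
  first replaced by \<open>B \<inter> T\<close>. The identity map on the right regards
  \<open>target\<close> as a measure on the whole space.\<close>

lemma distr_ray: "distr source borel ray = distr target borel (\<lambda>p. p)"
proof (rule measure_eqI)
  fix B assume "B \<in> sets (distr source borel ray)"
  then have B: "B \<in> sets borel" by simp
  have id: "(\<lambda>p. p) \<in> borel_measurable (lebesgue_on T)"
    by (rule borel_lebesgue_on) simp
  have BT: "B \<inter> T \<in> sets borel"
    using B T_borel by simp
  have "emeasure (distr source borel ray) B = emeasure source (ray -` B \<inter> \<Omega>)"
    using B ray_measurable by (subst emeasure_distr) simp_all
  also have "\<dots> = emeasure source (ray -` (B \<inter> T) \<inter> \<Omega>)"
    using AE_source_ray_in_T measurable_sets[OF ray_measurable B] measurable_sets[OF ray_measurable BT]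
    by (intro emeasure_eq_AE) auto
  also have "\<dots> = emeasure target (B \<inter> T)"
    using measure_source_ray_vimage[OF BT] by (simp add: source.emeasure_eq_measure target.emeasure_eq_measure)
  also have "\<dots> = emeasure (distr target borel (\<lambda>p. p)) B"
    using B id by (subst emeasure_distr) simp_all
  finally show "emeasure (distr source borel ray) B = emeasure (distr target borel (\<lambda>p. p)) B" .
qed simp

text \<open>On an \<open>I dx\<close>-null set the ray tracing map may be unspecified or lie in the boundary of
  \<open>T\<close>, which need not be Lebesgue null.\<close>

definition "ray_plan x = (if ray x \<in> T then ray x else (SOME p. p \<in> T))"

lemma ray_plan_in_T: "ray_plan x \<in> T"
  using T_nonempty by (simp add: ray_plan_def some_in_eq)

lemma AE_ray_plan: "AE x in source. ray x = ray_plan x"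
  using AE_source_ray_in_T by eventually_elim (simp add: ray_plan_def)

text \<open>Change of variables through the equality of the two push-forward measures.\<close>

lemma plan_map_ray_plan: "plan_map \<Omega> T I L ray_plan"
proof -
  have meas: "ray_plan \<in> borel_measurable (lebesgue_on \<Omega>)"
    unfolding ray_plan_def using ray_measurable T_borel by measurable
  have "(LINT x:\<Omega>|lebesgue. h (ray_plan x) * I x) = (LINT p:T|lebesgue. h p * L p)"
    if h: "continuous_on (closure T) h" for h :: "'a \<Rightarrow> real"
  proof -
    \<comment> \<open>The test function \<open>h\<close> is controlled only on
      \<open>closure T\<close>; cutting it off outside \<open>T\<close> gives a function that is
      Borel on the whole space.\<close>
    define H where "H p = indicator T p * h p" for p
    have H: "H \<in> borel_measurable borel"
      unfolding H_def using borel_measurable_continuous_on_indicator[OF T_borel continuous_on_subset[OF h closure_subset]]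
      by simp
    have hH: "h p = H p" if "p \<in> T" for p
      using that by (simp add: H_def)
    have "(LINT x:\<Omega>|lebesgue. h (ray_plan x) * I x) = (\<integral>x. H (ray_plan x) \<partial>source)"
      using measurable_compose[OF meas H]
      by (simp add: hH[OF ray_plan_in_T] set_lebesgue_integral_eq_density[OF \<Omega>_sets I_int I_nonneg])
    also have "\<dots> = (\<integral>x. H (ray x) \<partial>source)"
    proof (rule integral_cong_AE)
      show "AE x in source. H (ray_plan x) = H (ray x)"
        using AE_ray_plan by eventually_elim simp
    qed (use measurable_compose[OF meas H] measurable_compose[OF ray_measurable H] in simp_all)
    also have "\<dots> = (\<integral>p. H p \<partial>distr source borel ray)"
      using H ray_measurable by (subst integral_distr) simp_all
    also have "\<dots> = (\<integral>p. H p \<partial>target)"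
      unfolding distr_ray using H by (subst integral_distr) (simp_all add: borel_lebesgue_on)
    also have "\<dots> = (LINT p:T|lebesgue. H p * L p)"
      using H by (intro set_lebesgue_integral_eq_density[symmetric] T_sets L_int L_nonneg borel_lebesgue_on)
    also have "\<dots> = (LINT p:T|lebesgue. h p * L p)"
      by (intro set_lebesgue_integral_cong T_sets) (simp add: hH)
    finally show ?thesis .
  qed
  then show ?thesis
    using meas ray_plan_in_T by (simp add: plan_map_def measurable_restrict_space2_iff)
qed

lemma plan_ray: "plan \<Omega> T I L ray"
  unfolding plan_def
proof (intro exI conjI)
  show "plan_map \<Omega> T I L ray_plan"
    by (rule plan_map_ray_plan)
  show "AE x in source. ray x = ray_plan x"
    by (rule AE_ray_plan)
qed

section \<open>Duality gap, optimality and uniqueness\<close>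

text \<open>Where \<open>I\<close> vanishes on \<Omega>, both integrands are 0 whatever the maps do;
  where it is positive, the maps agree up to a Lebesgue null set.\<close>

lemma quadratic_cost_cong_AE:
  assumes "AE x in source. P x = P' x"
  shows "quadratic_cost \<Omega> I P = quadratic_cost \<Omega> I P'"
proof -
  have "AE x in lebesgue. x \<in> \<Omega> \<longrightarrow> (norm (x - P x))\<^sup>2 * I x = (norm (x - P' x))\<^sup>2 * I x"
    using AE_density_lebesgue_onD[OF \<Omega>_sets I_int assms]
    by eventually_elim (use I_nonneg in \<open>force simp: less_le\<close>)
  then show ?thesis
    unfolding quadratic_cost_def by (simp only: set_lebesgue_integral_cong_AE_lebesgue)
qed

text \<open>The slack in the dual inequality between the transport cost and the potentials.\<close>

definition "gap x p = V x - Q_fun \<beta> w x p"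

lemma gap_nonneg: "p \<in> closure T \<Longrightarrow> 0 \<le> gap x p"
  using Q_fun_le_V_star[OF domain_T(2) w_continuous] by (simp add: gap_def)

text \<open>Zero gap means that \<open>p\<close> is a maximizer, hence the only subgradient.
  Conversely, the supremum is attained at some \<open>q\<close>, and uniqueness of the subgradient
  forces \<open>q = ray x\<close>.\<close>

lemma gap_eq_0_iff:
  assumes "ray_set T \<beta> w x = {ray x}" "p \<in> closure T"
  shows "gap x p = 0 \<longleftrightarrow> p = ray x"
proof
  assume "gap x p = 0"
  then show "p = ray x"
    using maximizer_in_ray_set[OF domain_T(2) w_continuous assms(2), of \<beta> x] assms(1)
    by (simp add: gap_def)
next
  obtain q where q: "q \<in> closure T" "V x = Q_fun \<beta> w x q"
    using V_star_attained[OF w_assms] by blast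
  assume "p = ray x"
  moreover have "q = ray x"
    using maximizer_in_ray_set[OF domain_T(2) w_continuous q] assms(1) by simp
  ultimately show "gap x p = 0"
    using q by (simp add: gap_def)
qed

text \<open>The Kantorovich dual value of the potentials \<open>(norm x)\<^sup>2 / 2 - V x\<close>
  and \<open>\<beta> * w p\<close>, whose sum is at most
  \<open>(norm (x - p))\<^sup>2 / 2\<close>.\<close>

definition "dual_cost = (\<integral>x. (norm x)\<^sup>2 / 2 - V x \<partial>source) + \<beta> * (LINT p:T|lebesgue. w p * L p)"

text \<open>Integrating the pointwise definition of the gap along \<open>P\<close> leaves one term
  that depends on the plan, namely the integral of \<open>w (P x)\<close>; measure preservation with
  test function \<open>w\<close> makes it a constant.\<close>

lemma
  assumes P: "plan_map \<Omega> T I L P"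
  shows integrable_gap: "integrable source (\<lambda>x. gap x (P x))"
    and quadratic_cost_eq_dual_cost: "quadratic_cost \<Omega> I P = dual_cost + (\<integral>x. gap x (P x) \<partial>source)"
proof -
  have P_in: "P x \<in> T" if "x \<in> \<Omega>" for x
    using P that by (auto simp: plan_map_def measurable_restrict_space2_iff)
  have meas_P: "P \<in> borel_measurable (lebesgue_on \<Omega>)"
    using P by (simp add: plan_map_def measurable_restrict_space2_iff)
  \<comment> \<open>The measure \<open>source\<close> is finite, so uniform bounds suffice;
    \<open>R\<close>, \<open>S\<close>, \<open>U\<close> and \<open>W\<close> below provide them
    from compact closures.\<close>
  have bounded_integrable: "integrable source f"
    if "f \<in> borel_measurable (lebesgue_on \<Omega>)" "\<And>x. x \<in> \<Omega> \<Longrightarrow> norm (f x) \<le> B" for f :: "'a \<Rightarrow> real" and B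
    using that by (intro source.integrable_const_bound[where B = B] AE_I2) simp_all
  obtain R where R: "\<And>x. x \<in> \<Omega> \<Longrightarrow> norm x \<le> R"
    using continuous_on_closure_norm_boundE[OF domain_\<Omega>(2) continuous_on_id] by blast
  obtain S where S: "\<And>p. p \<in> T \<Longrightarrow> norm p \<le> S"
    using continuous_on_closure_norm_boundE[OF domain_T(2) continuous_on_id] by blast
  obtain U where U: "\<And>x. x \<in> \<Omega> \<Longrightarrow> norm (V x) \<le> U"
    using continuous_on_closure_norm_boundE[OF domain_\<Omega>(2)
        continuous_on_subset[OF continuous_on_V_star[OF w_assms] subset_UNIV]] by blast
  obtain W where W: "\<And>p. p \<in> T \<Longrightarrow> norm (w p) \<le> W"
    using continuous_on_closure_norm_boundE[OF domain_T(2) w_continuous] by blast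
  have meas_id: "(\<lambda>x. x) \<in> borel_measurable (lebesgue_on \<Omega>)"
    by (rule borel_lebesgue_on) simp
  have meas_cost: "(\<lambda>x. (norm (x - P x))\<^sup>2) \<in> borel_measurable (lebesgue_on \<Omega>)"
    using meas_P meas_id by measurable
  have int_cost: "integrable source (\<lambda>x. (norm (x - P x))\<^sup>2)"
  proof (rule bounded_integrable[OF meas_cost])
    fix x assume "x \<in> \<Omega>"
    then have "norm x \<le> R" "norm (P x) \<le> S"
      using R S P_in by blast+
    then have "norm (x - P x) \<le> R + S"
      using norm_triangle_ineq4[of x "P x"] by linarith
    then show "norm ((norm (x - P x))\<^sup>2) \<le> (R + S)\<^sup>2"
      by (simp add: power_mono)
  qed
  have meas_pot: "(\<lambda>x. (norm x)\<^sup>2 / 2 - V x) \<in> borel_measurable (lebesgue_on \<Omega>)"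
    using borel_measurable_continuous_onI[OF continuous_on_V_star[OF w_assms]]
    by (intro borel_lebesgue_on) measurable
  have int_pot: "integrable source (\<lambda>x. (norm x)\<^sup>2 / 2 - V x)"
  proof (rule bounded_integrable[OF meas_pot])
    fix x assume "x \<in> \<Omega>"
    then have "norm x \<le> R" "norm (V x) \<le> U"
      using R U by blast+
    moreover from this have "(norm x)\<^sup>2 \<le> R\<^sup>2"
      by (simp add: power_mono)
    ultimately show "norm ((norm x)\<^sup>2 / 2 - V x) \<le> R\<^sup>2 / 2 + U"
      using norm_triangle_ineq4[of "(norm x)\<^sup>2 / 2" "V x"] by simp
  qed
  have meas_w: "(\<lambda>x. w (P x)) \<in> borel_measurable (lebesgue_on \<Omega>)"
  proof (rule measurable_compose[where f = P and g = w])
    show "P \<in> measurable (lebesgue_on \<Omega>) (restrict_space borel T)"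
      using P by (simp add: plan_map_def)
    show "w \<in> borel_measurable (restrict_space borel T)"
      using continuous_on_subset[OF w_continuous closure_subset]
      by (rule borel_measurable_continuous_on_restrict)
  qed
  have int_w: "integrable source (\<lambda>x. w (P x))"
    using W P_in by (intro bounded_integrable[OF meas_w, of W]) blast
  \<comment> \<open>Expanding the square: the inner product in \<open>Q_fun\<close> is the cross
    term.\<close>
  have eq: "gap x (P x) = (norm (x - P x))\<^sup>2 / 2 - ((norm x)\<^sup>2 / 2 - V x) - \<beta> * w (P x)" for x
    by (simp add: gap_def Q_fun_def power2_norm_eq_inner inner_diff_left inner_diff_right
        inner_commute field_simps)
  show "integrable source (\<lambda>x. gap x (P x))"
    unfolding eq using int_cost int_pot int_w by simp
  have "quadratic_cost \<Omega> I P = (\<integral>x. (norm (x - P x))\<^sup>2 \<partial>source) / 2"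
    by (simp add: quadratic_cost_def
        set_lebesgue_integral_eq_density[OF \<Omega>_sets I_int I_nonneg meas_cost])
  moreover have "(LINT p:T|lebesgue. w p * L p) = (\<integral>x. w (P x) \<partial>source)"
    using P w_continuous set_lebesgue_integral_eq_density[OF \<Omega>_sets I_int I_nonneg meas_w]
    by (simp add: plan_map_def)
  moreover have "(\<integral>x. gap x (P x) \<partial>source) = (\<integral>x. (norm (x - P x))\<^sup>2 \<partial>source) / 2
      - (\<integral>x. (norm x)\<^sup>2 / 2 - V x \<partial>source) - \<beta> * (\<integral>x. w (P x) \<partial>source)"
    unfolding eq using int_cost int_pot int_w by simp
  ultimately show "quadratic_cost \<Omega> I P = dual_cost + (\<integral>x. gap x (P x) \<partial>source)"
    by (simp add: dual_cost_def)
qed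

lemma AE_gap_nonneg:
  assumes "plan_map \<Omega> T I L P"
  shows "AE x in source. P x \<in> closure T \<and> 0 \<le> gap x (P x)"
proof -
  have "P x \<in> closure T" if "x \<in> \<Omega>" for x
    using assms that closure_subset by (auto simp: plan_map_def measurable_restrict_space2_iff)
  then show ?thesis
    using gap_nonneg by (intro AE_I2) simp
qed

text \<open>The cost formula requires a genuine \<open>plan_map\<close>, so it is applied to
  \<open>ray_plan\<close>, whose gap vanishes almost everywhere.\<close>

lemma quadratic_cost_ray: "quadratic_cost \<Omega> I ray = dual_cost"
proof -
  have "AE x in source. gap x (ray_plan x) = 0"
    using AE_source_ray AE_ray_plan AE_gap_nonneg[OF plan_map_ray_plan]
    by eventually_elim (simp add: gap_eq_0_iff)
  then have "(\<integral>x. gap x (ray_plan x) \<partial>source) = 0"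
    by (rule integral_eq_zero_AE)
  then show ?thesis
    using quadratic_cost_cong_AE[OF AE_ray_plan] quadratic_cost_eq_dual_cost[OF plan_map_ray_plan] by simp
qed

lemma dual_cost_le:
  assumes "plan \<Omega> T I L P"
  shows "dual_cost \<le> quadratic_cost \<Omega> I P"
proof -
  obtain P' where P': "plan_map \<Omega> T I L P'" "AE x in source. P x = P' x"
    using assms by (auto simp: plan_def)
  have "AE x in source. 0 \<le> gap x (P' x)"
    using AE_gap_nonneg[OF P'(1)] by eventually_elim simp
  then have "0 \<le> (\<integral>x. gap x (P' x) \<partial>source)"
    by (rule integral_nonneg_AE)
  then show ?thesis
    using quadratic_cost_eq_dual_cost[OF P'(1)] quadratic_cost_cong_AE[OF P'(2)] by simp
qed

lemma minimizing_plan_ray: "minimizing_plan \<Omega> T I L ray"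
  using plan_ray dual_cost_le by (simp add: minimizing_plan_def quadratic_cost_ray)

text \<open>Comparison with the cost of \<open>ray\<close> forces the nonnegative gap to have
  integral 0, so it vanishes almost everywhere for \<open>source\<close>, and zero gap identifies
  the point \<open>ray x\<close>.\<close>

lemma minimizing_plan_eq_ray:
  assumes "minimizing_plan \<Omega> T I L P"
  shows "AE x in source. P x = ray x"
proof -
  obtain P' where P': "plan_map \<Omega> T I L P'" "AE x in source. P x = P' x"
    using assms by (auto simp: plan_def minimizing_plan_def)
  have "dual_cost + (\<integral>x. gap x (P' x) \<partial>source) \<le> dual_cost"
    using assms plan_ray quadratic_cost_ray quadratic_cost_eq_dual_cost[OF P'(1)]
      quadratic_cost_cong_AE[OF P'(2)] by (force simp: minimizing_plan_def)
  moreover have nonneg: "AE x in source. 0 \<le> gap x (P' x)"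
    using AE_gap_nonneg[OF P'(1)] by eventually_elim simp
  ultimately have "(\<integral>x. gap x (P' x) \<partial>source) = 0"
    using integral_nonneg_AE[OF nonneg] by simp
  then have "AE x in source. gap x (P' x) = 0"
    using integral_nonneg_eq_0_iff_AE[OF integrable_gap[OF P'(1)] nonneg] by simp
  then show ?thesis
    using AE_source_ray AE_gap_nonneg[OF P'(1)] P'(2)
    by eventually_elim (simp add: gap_eq_0_iff)
qed

text \<open>The support lies in \<open>closure \<Omega>\<close>, so removing the zeros leaves only
  points of \<Omega> with \<open>0 < I x\<close>, where null sets of \<open>source\<close> are
  Lebesgue null.\<close>

lemma minimizing_plan_eq_ray_on_supp:
  assumes "minimizing_plan \<Omega> T I L P"
  shows "AE x in lebesgue. x \<in> supp \<Omega> I - {x \<in> closure \<Omega>. zero_ext \<Omega> I x = 0} \<longrightarrow> P x = ray x"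
proof -
  have "{x. zero_ext \<Omega> I x \<noteq> 0} \<subseteq> \<Omega>"
    by (auto simp: zero_ext_def)
  then have "supp \<Omega> I \<subseteq> closure \<Omega>"
    by (simp add: supp_def closure_mono)
  have pos: "x \<in> \<Omega> \<and> 0 < I x" if "x \<in> supp \<Omega> I - {x \<in> closure \<Omega>. zero_ext \<Omega> I x = 0}" for x
  proof -
    have nz: "zero_ext \<Omega> I x \<noteq> 0"
      using that \<open>supp \<Omega> I \<subseteq> closure \<Omega>\<close> by blast
    then have "x \<in> \<Omega>"
      by (metis zero_ext_def)
    with nz I_nonneg[of x] show ?thesis
      by (simp add: zero_ext_def)
  qed
  show ?thesis
    using AE_density_lebesgue_onD[OF \<Omega>_sets I_int minimizing_plan_eq_ray[OF assms]]
    by eventually_elim (use pos in blast)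
qed

end

theorem theorem6p1:
  fixes \<Omega> T :: "(real ^ 'n) set" and I L z w :: "real ^ 'n \<Rightarrow> real" and \<beta> :: real
  assumes "CARD('n) \<ge> 2"
    and "is_domain \<Omega>" and "bounded \<Omega>"
    and "is_domain T" and "bounded T"
    and "\<beta> > 0"
    and "\<And>x. x \<in> \<Omega> \<Longrightarrow> I x \<ge> 0" and "set_integrable lebesgue \<Omega> I"
    and "\<And>p. p \<in> T \<Longrightarrow> L p \<ge> 0" and "set_integrable lebesgue T L"
    and "(LINT p:T|lebesgue. L p) = (LINT x:\<Omega>|lebesgue. I x)"
    and "weak_solution_A \<Omega> T I L \<beta> z w"
  shows "minimizing_plan \<Omega> T I L (ray_map T \<beta> w) \<and>
    (\<forall>P. minimizing_plan \<Omega> T I L P \<longrightarrow>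
      (AE x in lebesgue. x \<in> supp \<Omega> I - {x \<in> closure \<Omega>. zero_ext \<Omega> I x = 0} \<longrightarrow>
         P x = ray_map T \<beta> w x))"
proof -
  interpret two_reflector_solution \<Omega> T I L z w \<beta>
    by (rule two_reflector_solution.intro) (fact assms)+
  show ?thesis
    by (intro conjI allI impI minimizing_plan_ray minimizing_plan_eq_ray_on_supp)
qed

end
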